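(* Let $\Gamma$ be a Jordan curve in $\mathbb{C}$. Suppose that there exists an open half-plane $\mathbb{H}\subset\mathbb{C}$ such that $\Gamma\subset\overline{\mathbb{H}}$ and $\Gamma\cap\partial\mathbb{H}$ is a line segment (of positive length). Then $\Gamma$ is not MP-solvable.
   Context: $\widehat{\mathbb{C}}$ denotes the Riemann sphere. For a Jordan curve $\Gamma\subset\mathbb{C}$, let $\Omega$ and $\Omega^*$ be the bounded and unbounded components of $\widehat{\mathbb{C}}\setminus\Gamma$ (so $\infty\in\Omega^*$). $A(\Omega)$ is the space of continuous functions on $\overline{\Omega}$ that are analytic in $\Omega$; $A(\Omega^* )$ is the space of continuous functions on $\overline{\Omega^*}$ (closure in $\widehat{\mathbb{C}}$) that are analytic in $\Omega^*$ and vanish at $\infty$. The curve $\Gamma$ is called MP-solvable if there exist non-constant functions $f\in A(\Omega)$ and $g\in A(\Omega^* )$ such that $f=\overline{g}$ on $\Gamma$ (complex conjugate). *)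

theory Defs
  imports "HOL-Analysis.Analysis"
begin

definition jordan_curve :: "complex set \<Rightarrow> bool" where
  "jordan_curve \<Gamma> \<longleftrightarrow>
     (\<exists>\<gamma>. simple_path \<gamma> \<and> pathfinish \<gamma> = pathstart \<gamma> \<and> path_image \<gamma> = \<Gamma>)"

definition open_half_plane :: "complex set \<Rightarrow> bool" where
  "open_half_plane H \<longleftrightarrow> (\<exists>a b. a \<noteq> 0 \<and> H = {z. a \<bullet> z < b})"

(* The one-point compactification of the plane: None is the point at infinity. *)
definition riemann_sphere :: "complex option topology" where
  "riemann_sphere = Alexandroff_compactification euclidean"

(* Analyticity at infinity is tested in the chart w = 1/z. *)
definition sphere_analytic_on :: "(complex option \<Rightarrow> complex) \<Rightarrow> complex option set \<Rightarrow> bool" where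
  "sphere_analytic_on g U \<longleftrightarrow>
     (\<lambda>z. g (Some z)) analytic_on {z. Some z \<in> U} \<and>
     (None \<in> U \<longrightarrow> (\<lambda>w. g (if w = 0 then None else Some (1 / w))) analytic_on {0})"

(* The component of the sphere minus the curve that contains infinity. Its bounded
   counterpart is the library's inside \<Gamma>, a single component when \<Gamma> is a Jordan curve
   (Jordan_inside_outside). *)
definition jordan_exterior :: "complex set \<Rightarrow> complex option set" where
  "jordan_exterior \<Gamma> =
     connected_component_of_set
       (subtopology riemann_sphere (topspace riemann_sphere - Some ` \<Gamma>)) None"

lemma jordan_exterior_eq:
  assumes "jordan_curve \<Gamma>"
  shows "jordan_exterior \<Gamma> = insert None (Some ` outside \<Gamma>)" (is "_ = ?U")
proof -
  let ?X = riemann_sphere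
  obtain c where c: "simple_path c" "pathfinish c = pathstart c" "path_image c = \<Gamma>"
    using assms by (auto simp: jordan_curve_def)
  note J = Jordan_inside_outside[OF c(1,2), unfolded c(3)]
  have top: "topspace ?X = UNIV"
    by (auto simp: riemann_sphere_def) (metis not_None_eq rangeI)
  have bd: "bounded (- outside \<Gamma>)" "closed (- outside \<Gamma>)"
  proof -
    have "- outside \<Gamma> = inside \<Gamma> \<union> \<Gamma>" using J by blast
    moreover have "bounded \<Gamma>" using c bounded_simple_path_image by blast
    ultimately show "bounded (- outside \<Gamma>)" using J by simp
    show "closed (- outside \<Gamma>)" using J by (simp add: closed_def)
  qed
  have opU: "openin ?X ?U"
    unfolding riemann_sphere_def openin_Alexandroff_compactification
    using bd by (intro disjI2 exI[of _ "- outside \<Gamma>"]) (auto simp: compact_eq_bounded_closed)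
  have opI: "openin ?X (Some ` inside \<Gamma>)"
    using J by (simp add: riemann_sphere_def)
  have conn: "connectedin ?X (Some ` outside \<Gamma>)"
    unfolding riemann_sphere_def
    by (rule connectedin_continuous_map_image[OF continuous_map_Some]) (use J in auto)
  have "None \<in> ?X closure_of (Some ` outside \<Gamma>)"
    unfolding in_closure_of
  proof (intro conjI allI impI)
    show "None \<in> topspace ?X" using top by simp
    fix T assume "None \<in> T \<and> openin ?X T"
    then obtain C where "compact C" "T = insert None (Some ` (- C))"
      by (auto simp: riemann_sphere_def openin_Alexandroff_compactification Compl_eq_Diff_UNIV)
    moreover have "\<not> outside \<Gamma> \<subseteq> C"
      using J \<open>compact C\<close> bounded_subset compact_imp_bounded by blast
    ultimately show "\<exists>y. y \<in> Some ` outside \<Gamma> \<and> y \<in> T" by blast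
  qed
  moreover have "Some ` outside \<Gamma> \<subseteq> ?X closure_of (Some ` outside \<Gamma>)"
    by (rule closure_of_subset) (simp add: top)
  ultimately have cU: "connectedin ?X ?U"
    by (intro connectedin_intermediate_closure_of[OF conn]) auto
  let ?Y = "subtopology ?X (topspace ?X - Some ` \<Gamma>)"
  have disj: "?U \<inter> Some ` \<Gamma> = {}" by (auto simp: outside_def)
  show ?thesis
  proof
    show "?U \<subseteq> jordan_exterior \<Gamma>"
      unfolding jordan_exterior_def
      by (rule connected_component_of_maximal) (use cU disj top in \<open>auto simp: connectedin_subtopology\<close>)
    show "jordan_exterior \<Gamma> \<subseteq> ?U"
    proof
      fix y assume "y \<in> jordan_exterior \<Gamma>"
      then obtain T where T: "connectedin ?Y T" "None \<in> T" "y \<in> T"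
        unfolding jordan_exterior_def connected_component_of_def by blast
      then have T': "connectedin ?X T" "T \<inter> Some ` \<Gamma> = {}" by (auto simp: connectedin_subtopology)
      have "T \<subseteq> ?U \<union> Some ` inside \<Gamma>"
      proof
        fix x assume "x \<in> T" then show "x \<in> ?U \<union> Some ` inside \<Gamma>"
          using T'(2) J by (cases x) blast+
      qed
      moreover have "?U \<inter> Some ` inside \<Gamma> \<inter> T = {}" using inside_Int_outside[of \<Gamma>] by (force simp del: inside_Int_outside)
      moreover have "?U \<inter> T \<noteq> {}" using T by auto
      ultimately have "Some ` inside \<Gamma> \<inter> T = {}"
        using T'(1) opU opI unfolding connectedin by blast
      with \<open>T \<subseteq> _\<close> T(3) show "y \<in> ?U" by blast
    qed
  qed
qed

(* For bounded \<Omega> the closure in the plane is the closure in the sphere. *)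
definition A_int :: "complex set \<Rightarrow> (complex \<Rightarrow> complex) set" where
  "A_int \<Omega> = {f. continuous_on (closure \<Omega>) f \<and> f analytic_on \<Omega>}"

definition A_ext :: "complex option set \<Rightarrow> (complex option \<Rightarrow> complex) set" where
  "A_ext \<Omega> = {g. continuous_map (subtopology riemann_sphere (riemann_sphere closure_of \<Omega>)) euclidean g \<and>
                 sphere_analytic_on g \<Omega> \<and> g None = 0}"

(* Functions are total in HOL, so non-constancy refers to the closed domains on which
   membership in A_int and A_ext says something. *)
definition MP_solvable :: "complex set \<Rightarrow> bool" where
  "MP_solvable \<Gamma> \<longleftrightarrow>
     (\<exists>f \<in> A_int (inside \<Gamma>). \<exists>g \<in> A_ext (jordan_exterior \<Gamma>).
        \<not> f constant_on closure (inside \<Gamma>) \<and>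
        \<not> g constant_on (riemann_sphere closure_of jordan_exterior \<Gamma>) \<and>
        (\<forall>z\<in>\<Gamma>. f z = cnj (g (Some z))))"

end

theory Submission
  imports Defs "HOL-Complex_Analysis.Conformal_Mappings"
begin

text \<open>
  Let \<open>R\<close> be the reflection in the boundary line of the half-plane and
  \<open>F z = cnj (g (R z))\<close>, which is holomorphic on the half-plane. On the segment \<open>F\<close> agrees with
  \<open>cnj g = f\<close>, so by reflection (vanishing on a boundary arc) \<open>f = F\<close> inside \<open>\<Gamma>\<close>, hence
  \<open>F = cnj g\<close> on \<open>\<Gamma>\<close>. On the boundary line \<open>F = cnj g\<close> holds trivially, and both sides vanish at
  infinity. By the maximum principle the antiholomorphic \<open>cnj g\<close> coincides with the holomorphic
  \<open>F\<close> on the part of the half-plane outside \<open>\<Gamma>\<close>; so \<open>g\<close> is constant.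
\<close>

section \<open>Local shape of the curve at its straight segment\<close>

text \<open>Injectivity keeps other strands of the curve away from some interior point of the
  segment. The parameters mapped into a suitable subsegment form a compact connected set, which
  contains an interval; the parameters off that open interval have a compact image, and this image
  misses the value at the midpoint.\<close>

lemma simple_closed_path_segment_interior:
  fixes \<gamma> :: "real \<Rightarrow> complex"
  assumes \<gamma>: "simple_path \<gamma>" "pathfinish \<gamma> = pathstart \<gamma>"
    and pq: "p \<noteq> q" and sub: "closed_segment p q \<subseteq> path_image \<gamma>"
  obtains \<theta> e :: real where "0 < \<theta>" "\<theta> < 1" "0 < e"
    "ball (p + of_real \<theta> * (q - p)) e \<inter> path_image \<gamma> \<subseteq> closed_segment p q"
proof -
  define \<iota> where "\<iota> x = p + of_real x * (q - p)" for x :: real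
  have inj: "\<iota> x = \<iota> y \<longleftrightarrow> x = y" for x y
    using pq by (auto simp: \<iota>_def)
  have seg: "closed_segment p q = \<iota> ` {0..1}"
    by (auto simp: closed_segment_image_interval \<iota>_def scaleR_conv_of_real algebra_simps image_def)
  have cont\<iota>: "continuous_on X \<iota>" for X
    unfolding \<iota>_def by (intro continuous_intros)
  \<comment> \<open>a subsegment avoiding the base point, so that \<open>\<gamma>\<close> is injective on its preimage\<close>
  obtain \<theta>1 \<theta>2 :: real where th: "0 \<le> \<theta>1" "\<theta>1 < \<theta>2" "\<theta>2 \<le> 1" "\<gamma> 0 \<notin> \<iota> ` {\<theta>1..\<theta>2}"
  proof (cases "\<gamma> 0 \<in> \<iota> ` {0..1/3}")
    case True
    then have "\<gamma> 0 \<notin> \<iota> ` {1/2..1}" using inj by auto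
    then show ?thesis using that[of "1/2" 1] by simp
  next
    case False
    then show ?thesis using that[of 0 "1/3"] by simp
  qed
  define J where "J = \<iota> ` {\<theta>1..\<theta>2}"
  define T where "T = {0..1} \<inter> \<gamma> -` J"
  have J: "compact J" "connected J" "J \<subseteq> closed_segment p q"
    unfolding J_def seg using th
    by (auto intro!: compact_continuous_image connected_continuous_image cont\<iota>)
  have cont\<gamma>: "continuous_on {0..1} \<gamma>"
    using \<gamma> by (simp add: simple_path_def path_def)
  have "closed T"
    unfolding T_def using J by (intro continuous_closed_preimage cont\<gamma>) (auto simp: compact_imp_closed)
  then have T: "compact T"
    by (auto simp: T_def compact_eq_bounded_closed intro: bounded_subset[OF bounded_closed_interval])
  have T01: "0 < x" "x < 1" if "x \<in> T" for x
  proof -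
    have "\<gamma> 0 \<notin> J" "\<gamma> 1 \<notin> J" 
      using th \<gamma> by (auto simp: J_def pathfinish_def pathstart_def)
    then have "x \<noteq> 0" "x \<noteq> 1" using that by (auto simp: T_def)
    with that show "0 < x" "x < 1" by (auto simp: T_def)
  qed
  \<comment> \<open>\<open>loop_free\<close> lets only the parameters 0 and 1 share a value, and
    \<open>T\<close> contains neither.\<close>
  have inj\<gamma>: "x = y" if "x \<in> T" "y \<in> {0..1}" "\<gamma> x = \<gamma> y" for x y
  proof -
    have "x = y \<or> x = 0 \<and> y = 1 \<or> x = 1 \<and> y = 0"
      using \<gamma>(1) that unfolding simple_path_def loop_free_def T_def by blast
    with T01[OF that(1)] show ?thesis by auto
  qed
  have im: "\<gamma> ` T = J"
    using J sub by (force simp: T_def path_image_def)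
  \<comment> \<open>A continuous injection on a compact set is a homeomorphism onto its image, so
    \<open>T\<close> inherits connectedness from the subsegment \<open>J\<close>.\<close>
  have "\<exists>h. homeomorphism T J \<gamma> h"
    by (rule homeomorphism_compact[OF T _ im])
      (use inj\<gamma> in \<open>auto simp: T_def inj_on_def intro: continuous_on_subset[OF cont\<gamma>]\<close>)
  then have conT: "connected T"
    using J homeomorphic_connectedness homeomorphic_def by blast
  have "\<iota> \<theta>1 \<in> J" "\<iota> \<theta>2 \<in> J" using th by (auto simp: J_def)
  then obtain x1 x2 where x12: "x1 \<in> T" "x2 \<in> T" "\<gamma> x1 = \<iota> \<theta>1" "\<gamma> x2 = \<iota> \<theta>2"
    using im by (metis imageE)
  then have "x1 \<noteq> x2" using inj th by force
  define s t where "s = min x1 x2" and "t = max x1 x2"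
  have st: "s < t" "s \<in> T" "t \<in> T" "{s, t} = {x1, x2}"
    using \<open>x1 \<noteq> x2\<close> x12 by (auto simp: s_def t_def min_def max_def)
  have stT: "{s..t} \<subseteq> T" using connected_contains_Icc[OF conT] st by auto
  define x where "x = (s + t) / 2"
  have x: "s < x" "x < t" "x \<in> T" using st stT by (auto simp: x_def)
  then obtain \<theta> where \<theta>: "\<gamma> x = \<iota> \<theta>" "\<theta>1 \<le> \<theta>" "\<theta> \<le> \<theta>2"
    using im by (force simp: J_def)
  \<comment> \<open>As \<open>x\<close> differs from the parameters of both end points of
    \<open>J\<close>, injectivity puts \<theta> strictly between \<theta>1 and \<theta>2.\<close>
  have "x \<noteq> x1" "x \<noteq> x2" using x st by auto
  then have "\<theta> \<noteq> \<theta>1" "\<theta> \<noteq> \<theta>2"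
    using inj\<gamma>[of x1 x] inj\<gamma>[of x2 x] x12 x(3) \<theta>(1) by (auto simp: T_def)
  with \<theta> th have th01: "0 < \<theta>" "\<theta> < 1" by auto
  \<comment> \<open>\<open>C\<close> collects every strand other than the one over
    \<open>{s..t}\<close>; being closed and missing \<open>\<gamma> x\<close>, it leaves a ball in
    which only points of \<open>J\<close> remain.\<close>
  define C where "C = \<gamma> ` ({0..s} \<union> {t..1})"
  have "closed C"
    unfolding C_def using T01[of s] T01[of t] st
    by (intro compact_imp_closed compact_continuous_image continuous_on_subset[OF cont\<gamma>] compact_Un) auto
  moreover have "\<gamma> x \<notin> C"
  proof
    assume "\<gamma> x \<in> C"
    then obtain y where y: "y \<in> {0..s} \<union> {t..1}" "\<gamma> x = \<gamma> y" unfolding C_def by blast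
    then have "y \<in> {0..1}" using T01[OF st(2)] T01[OF st(3)] by auto
    then have "x = y" by (rule inj\<gamma>[OF x(3) _ y(2)])
    with x y show False by auto
  qed
  ultimately obtain e where e: "e > 0" "ball (\<gamma> x) e \<subseteq> - C"
    by (metis ComplI open_Compl open_contains_ball)
  have "ball (\<gamma> x) e \<inter> path_image \<gamma> \<subseteq> closed_segment p q"
  proof
    fix z assume z: "z \<in> ball (\<gamma> x) e \<inter> path_image \<gamma>"
    then obtain y where y: "y \<in> {0..1}" "z = \<gamma> y" by (auto simp: path_image_def)
    then have "\<gamma> y \<notin> C" using z e by blast
    then have "y \<in> {s..t}" using y by (auto simp: C_def)
    with stT im J y show "z \<in> closed_segment p q" by blast
  qed
  with th01 e \<theta> show ?thesis using that by (simp add: \<iota>_def)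
qed

lemma orthogonal_complex_multiple:
  fixes a w :: complex
  assumes "a \<noteq> 0" "a \<bullet> w = 0"
  obtains r :: real where "w = of_real r * (\<i> * a)"
proof
  have n: "(Re a)\<^sup>2 + (Im a)\<^sup>2 \<noteq> 0"
    using assms(1) by (simp add: complex_eq_iff sum_power2_eq_zero_iff)
  have o: "Re a * Re w + Im a * Im w = 0" using assms(2) by (simp add: inner_complex_def)
  \<comment> \<open>The coefficient is \<open>Im (cnj a * w) / (norm a)\<^sup>2\<close>, the
    coordinate of \<open>w\<close> along \<open>\<i> * a\<close>.\<close>
  show "w = of_real ((Re a * Im w - Im a * Re w) / ((Re a)\<^sup>2 + (Im a)\<^sup>2)) * (\<i> * a)"
  proof (rule complex_eqI)
    have "Re w * ((Re a)\<^sup>2 + (Im a)\<^sup>2) = - (Re a * Im w - Im a * Re w) * Im a"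
      using o by algebra
    then show "Re w = Re (of_real ((Re a * Im w - Im a * Re w) / ((Re a)\<^sup>2 + (Im a)\<^sup>2)) * (\<i> * a))"
      using n by (simp add: field_simps)
    have "Im w * ((Re a)\<^sup>2 + (Im a)\<^sup>2) = (Re a * Im w - Im a * Re w) * Re a"
      using o by algebra
    then show "Im w = Im (of_real ((Re a * Im w - Im a * Re w) / ((Re a)\<^sup>2 + (Im a)\<^sup>2)) * (\<i> * a))"
      using n by (simp add: field_simps)
  qed
qed

text \<open>The preceding ball gives one inclusion; shrinking it until it contains neither
  \<open>p\<close> nor \<open>q\<close> gives the other, because the line then meets it only within
  the segment. The curve thus cuts the ball into two half-discs, as needed for pasting across the
  line.\<close>

lemma jordan_curve_ball_in_line:
  assumes "jordan_curve \<Gamma>" "a \<noteq> 0" "p \<noteq> q" and seg: "\<Gamma> \<inter> {z. a \<bullet> z = b} = closed_segment p q"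
  obtains m e where "0 < e" "m \<in> \<Gamma>" "a \<bullet> m = b" "ball m e \<inter> \<Gamma> = ball m e \<inter> {z. a \<bullet> z = b}"
proof -
  obtain \<gamma> where \<gamma>: "simple_path \<gamma>" "pathfinish \<gamma> = pathstart \<gamma>" "path_image \<gamma> = \<Gamma>"
    using assms(1) by (auto simp: jordan_curve_def)
  have "closed_segment p q \<subseteq> path_image \<gamma>" using seg \<gamma> by blast
  then obtain \<theta> d :: real where th: "0 < \<theta>" "\<theta> < 1" "0 < d"
    "ball (p + of_real \<theta> * (q - p)) d \<inter> \<Gamma> \<subseteq> closed_segment p q"
    using simple_closed_path_segment_interior[OF \<gamma>(1,2) \<open>p \<noteq> q\<close>] \<gamma>(3) by metis
  define m where "m = p + of_real \<theta> * (q - p)"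
  have segI: "p + of_real x * (q - p) \<in> closed_segment p q" if "0 \<le> x" "x \<le> 1" for x
    using that by (auto simp: in_segment scaleR_conv_of_real algebra_simps intro!: exI[of _ x])
  have pq: "a \<bullet> p = b" "a \<bullet> q = b" using seg by auto
  have "a \<bullet> (q - p) = 0" using pq by (simp add: inner_diff_right)
  then obtain r where r: "q - p = of_real r * (\<i> * a)"
    using orthogonal_complex_multiple[OF \<open>a \<noteq> 0\<close>] by metis
  with \<open>p \<noteq> q\<close> have "r \<noteq> 0" by auto
  \<comment> \<open>The distances from \<open>m\<close> to \<open>p\<close> and to \<open>q\<close>
    are \<open>\<theta> * norm (q - p)\<close> and
    \<open>(1 - \<theta>) * norm (q - p)\<close>.\<close>
  define e where "e = min d (min \<theta> (1 - \<theta>) * norm (q - p))"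
  have e: "0 < e" "e \<le> d" "e \<le> \<theta> * norm (q - p)" "e \<le> (1 - \<theta>) * norm (q - p)"
  proof -
    have "min \<theta> (1 - \<theta>) * norm (q - p) \<le> \<theta> * norm (q - p)"
      "min \<theta> (1 - \<theta>) * norm (q - p) \<le> (1 - \<theta>) * norm (q - p)"
      by (intro mult_right_mono; simp)+
    then show "e \<le> d" "e \<le> \<theta> * norm (q - p)" "e \<le> (1 - \<theta>) * norm (q - p)"
      unfolding e_def by linarith+
    show "0 < e" using th \<open>p \<noteq> q\<close> by (simp add: e_def)
  qed
  have "z \<in> \<Gamma>" if z: "z \<in> ball m e" "a \<bullet> z = b" for z
  proof -
    have "a \<bullet> (z - p) = 0" using z pq by (simp add: inner_diff_right)
    then obtain s where "z - p = of_real s * (\<i> * a)"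
      using orthogonal_complex_multiple[OF \<open>a \<noteq> 0\<close>] by metis
    then have zp: "z = p + of_real (s / r) * (q - p)"
      using r \<open>r \<noteq> 0\<close> by (simp add: field_simps)
    have "m - z = of_real (\<theta> - s / r) * (q - p)"
      by (simp add: m_def zp algebra_simps)
    then have "dist m z = \<bar>\<theta> - s / r\<bar> * norm (q - p)"
      by (simp add: dist_norm norm_mult del: of_real_diff of_real_divide)
    with z have "\<bar>\<theta> - s / r\<bar> * norm (q - p) < e" by simp
    then have "\<bar>\<theta> - s / r\<bar> * norm (q - p) < \<theta> * norm (q - p)"
      "\<bar>\<theta> - s / r\<bar> * norm (q - p) < (1 - \<theta>) * norm (q - p)" using e by linarith+
    then have "\<bar>\<theta> - s / r\<bar> < \<theta>" "\<bar>\<theta> - s / r\<bar> < 1 - \<theta>"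
      using mult_less_cancel_right_pos[of "norm (q - p)"] \<open>p \<noteq> q\<close> by simp_all
    then have "0 \<le> s / r" "s / r \<le> 1" by linarith+
    then have "z \<in> closed_segment p q" unfolding zp by (rule segI)
    then show ?thesis using seg by blast
  qed
  moreover have "ball m e \<inter> \<Gamma> \<subseteq> {z. a \<bullet> z = b}"
    using th(4) e seg unfolding m_def by force
  moreover have "m \<in> \<Gamma>" "a \<bullet> m = b" using segI[of \<theta>] th seg by (auto simp: m_def)
  ultimately show ?thesis using that e by blast
qed

section \<open>Maximum principle with decay at infinity\<close>

text \<open>\<open>U\<close> may be unbounded. Decay bounds \<open>Re h\<close> by \<open>e\<close>
  on a large circle, so the maximum modulus principle applies to \<open>exp (h w)\<close>, of
  modulus \<open>exp (Re (h w))\<close>, on the truncated domain; then \<open>e\<close> tends to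
  0.\<close>

lemma maximum_Re_vanishing_at_infinity:
  fixes h :: "complex \<Rightarrow> complex"
  assumes "open U" "h holomorphic_on U" "continuous_on (closure U) h"
    and fr: "\<And>z. z \<in> frontier U \<Longrightarrow> Re (h z) \<le> 0"
    and inf: "\<And>e. 0 < e \<Longrightarrow> \<exists>B. \<forall>z\<in>closure U. B \<le> norm z \<longrightarrow> norm (h z) \<le> e"
    and z: "z \<in> U"
  shows "Re (h z) \<le> 0"
proof (rule field_le_epsilon)
  fix e :: real assume "0 < e"
  then obtain B where B: "\<And>z. z \<in> closure U \<Longrightarrow> B \<le> norm z \<Longrightarrow> norm (h z) \<le> e"
    using inf by blast
  \<comment> \<open>Large enough that \<open>h\<close> is small on the circle and that
    \<open>z\<close> lies inside it.\<close>
  define r where "r = max B (norm z) + 1"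
  define S where "S = U \<inter> ball 0 r"
  have clS: "closure S \<subseteq> closure U" unfolding S_def by (intro closure_mono) auto
  have "r > 0" using norm_ge_zero[of z] unfolding r_def by linarith
  have "norm (exp (h z)) \<le> exp e"
  proof (rule maximum_modulus_frontier[of "\<lambda>w. exp (h w)" S])
    show "(\<lambda>w. exp (h w)) holomorphic_on interior S"
    proof -
      have "interior S \<subseteq> U" using interior_subset[of S] by (auto simp: S_def)
      then show ?thesis
        by (intro holomorphic_intros holomorphic_on_subset[OF assms(2)])
    qed
    show "continuous_on (closure S) (\<lambda>w. exp (h w))"
      by (intro continuous_intros continuous_on_subset[OF assms(3) clS])
    show "bounded S" unfolding S_def by auto
    show "z \<in> S" using z by (auto simp: S_def r_def)
    fix w assume w: "w \<in> frontier S"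
    then have wU: "w \<in> closure U" using clS by (auto simp: frontier_def)
    have "w \<in> frontier U \<or> norm w = r"
      using w frontier_Int_subset[of U "ball 0 r"] \<open>r > 0\<close> by (auto simp: S_def)
    then have "Re (h w) \<le> e"
    proof
      assume "norm w = r"
      then have "norm (h w) \<le> e" using B wU by (auto simp: r_def)
      then show ?thesis using complex_Re_le_cmod order_trans by blast
    qed (use fr \<open>0 < e\<close> in force)
    then show "norm (exp (h w)) \<le> exp e" by simp
  qed
  then show "Re (h z) \<le> 0 + e" by simp
qed

text \<open>By the open mapping theorem a non-constant \<open>h\<close> would have an open image,
  which cannot fit in the imaginary axis.\<close>

lemma holomorphic_Re_eq_0_constant_on:
  assumes "h holomorphic_on S" "open S" "connected S" "\<And>z. z \<in> S \<Longrightarrow> Re (h z) = 0"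
  shows "h constant_on S"
proof (rule ccontr)
  assume nc: "\<not> h constant_on S"
  then have "S \<noteq> {}" by (auto simp: constant_on_def)
  then obtain z where z: "z \<in> S" by blast
  have "open (h ` S)" using open_mapping_thm[of h S S] assms nc by auto
  then obtain e where e: "e > 0" "ball (h z) e \<subseteq> h ` S"
    using z open_contains_ball by blast
  have "h z + of_real (e / 2) \<in> ball (h z) e" using e by (simp add: dist_norm)
  with e(2) have "h z + of_real (e / 2) \<in> h ` S" by (rule subsetD)
  then have "Re (h z + of_real (e / 2)) = 0" using assms(4) by force
  with assms(4)[OF z] e show False by simp
qed

text \<open>The maximum principle for \<open>h\<close> and \<open>- h\<close> makes
  \<open>Re h\<close> vanish on \<open>U\<close>. \<open>U\<close> is not assumed connected, hence
  the connected open part \<open>D\<close>.\<close>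

lemma vanishing_Re_constant_on:
  fixes h :: "complex \<Rightarrow> complex"
  assumes "open U" "h holomorphic_on U" "continuous_on (closure U) h"
    and fr: "\<And>z. z \<in> frontier U \<Longrightarrow> Re (h z) = 0"
    and inf: "\<And>e. 0 < e \<Longrightarrow> \<exists>B. \<forall>z\<in>closure U. B \<le> norm z \<longrightarrow> norm (h z) \<le> e"
    and D: "D \<subseteq> U" "open D" "connected D"
  shows "h constant_on D"
proof (rule holomorphic_Re_eq_0_constant_on)
  fix z assume "z \<in> D"
  then have z: "z \<in> U" using D by blast
  have "Re (h z) \<le> 0"
    by (rule maximum_Re_vanishing_at_infinity[OF assms(1-3) _ inf z]) (simp_all add: fr)
  moreover have "Re (- h z) \<le> 0"
  proof (rule maximum_Re_vanishing_at_infinity[OF assms(1) _ _ _ _ z])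
    show "(\<lambda>z. - h z) holomorphic_on U" by (intro holomorphic_intros assms)
    show "continuous_on (closure U) (\<lambda>z. - h z)" by (intro continuous_intros assms)
  qed (simp_all add: fr inf)
  ultimately show "Re (h z) = 0" by simp
qed (use D(2,3) holomorphic_on_subset[OF assms(2) D(1)] in simp_all)

section \<open>The exterior function in planar terms\<close>

lemma jordan_exterior_closure_of:
  assumes "jordan_curve \<Gamma>"
  shows "riemann_sphere closure_of jordan_exterior \<Gamma> = insert None (Some ` (outside \<Gamma> \<union> \<Gamma>))"
proof -
  obtain c where c: "simple_path c" "pathfinish c = pathstart c" "path_image c = \<Gamma>"
    using assms by (auto simp: jordan_curve_def)
  note J = Jordan_inside_outside[OF c(1,2), unfolded c(3)]
  have top: "topspace riemann_sphere = UNIV"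
    by (auto simp: riemann_sphere_def) (metis not_None_eq rangeI)
  have cl: "closure (outside \<Gamma>) = outside \<Gamma> \<union> \<Gamma>"
  proof -
    have "frontier (outside \<Gamma>) = \<Gamma>" using J by blast
    then show ?thesis using closure_Un_frontier[of "outside \<Gamma>"] by simp
  qed
  show ?thesis
  proof
    have "openin riemann_sphere (Some ` inside \<Gamma>)"
      using J by (simp add: riemann_sphere_def)
    moreover have "insert None (Some ` (outside \<Gamma> \<union> \<Gamma>)) = topspace riemann_sphere - Some ` inside \<Gamma>"
    proof (rule set_eqI)
      fix x show "x \<in> insert None (Some ` (outside \<Gamma> \<union> \<Gamma>)) \<longleftrightarrow> x \<in> topspace riemann_sphere - Some ` inside \<Gamma>"
        using union_with_inside[of \<Gamma>] inside_Int_outside[of \<Gamma>] inside_no_overlap[of \<Gamma>]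
          inside_Un_outside[of \<Gamma>] top by (cases x) blast+
    qed
    ultimately have "closedin riemann_sphere (insert None (Some ` (outside \<Gamma> \<union> \<Gamma>)))"
      by (metis closedin_diff closedin_topspace)
    then show "riemann_sphere closure_of jordan_exterior \<Gamma> \<subseteq> insert None (Some ` (outside \<Gamma> \<union> \<Gamma>))"
      by (intro closure_of_minimal) (auto simp: jordan_exterior_eq[OF assms])
    have "continuous_map euclidean riemann_sphere Some"
      by (simp add: riemann_sphere_def continuous_map_Some)
    then have "Some ` (outside \<Gamma> \<union> \<Gamma>) \<subseteq> riemann_sphere closure_of (Some ` outside \<Gamma>)"
      using continuous_map_image_closure_subset[of euclidean riemann_sphere Some "outside \<Gamma>"] cl
      by simp
    also have "\<dots> \<subseteq> riemann_sphere closure_of jordan_exterior \<Gamma>"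
      by (intro closure_of_mono) (auto simp: jordan_exterior_eq[OF assms])
    finally show "insert None (Some ` (outside \<Gamma> \<union> \<Gamma>)) \<subseteq> riemann_sphere closure_of jordan_exterior \<Gamma>"
      using closure_of_subset[of "jordan_exterior \<Gamma>" riemann_sphere] top jordan_exterior_eq[OF assms]
      by auto
  qed
qed

text \<open>Translates membership on the sphere to the plane; continuity at \<open>None\<close>
  together with \<open>g None = 0\<close> becomes decay at infinity.\<close>

lemma A_ext_planeD:
  assumes "jordan_curve \<Gamma>" and g: "g \<in> A_ext (jordan_exterior \<Gamma>)"
  shows "(\<lambda>z. g (Some z)) holomorphic_on outside \<Gamma>"
    and "continuous_on (outside \<Gamma> \<union> \<Gamma>) (\<lambda>z. g (Some z))"
    and "0 < e \<Longrightarrow> \<exists>B. \<forall>z\<in>outside \<Gamma> \<union> \<Gamma>. B \<le> norm z \<longrightarrow> norm (g (Some z)) < e"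
proof -
  let ?K = "insert None (Some ` (outside \<Gamma> \<union> \<Gamma>))"
  have g': "continuous_map (subtopology riemann_sphere ?K) euclidean g"
    "sphere_analytic_on g (jordan_exterior \<Gamma>)" "g None = 0"
    using g by (auto simp: A_ext_def jordan_exterior_closure_of[OF assms(1)])
  have "{z. Some z \<in> jordan_exterior \<Gamma>} = outside \<Gamma>"
    by (auto simp: jordan_exterior_eq[OF assms(1)])
  then show "(\<lambda>z. g (Some z)) holomorphic_on outside \<Gamma>"
    using g'(2) by (simp add: sphere_analytic_on_def analytic_imp_holomorphic)
  have "continuous_map (top_of_set (outside \<Gamma> \<union> \<Gamma>)) (subtopology riemann_sphere ?K) Some"
    unfolding riemann_sphere_def
    by (intro continuous_map_into_subtopology continuous_map_from_subtopology continuous_map_Some) auto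
  from continuous_map_compose[OF this g'(1)]
  show "continuous_on (outside \<Gamma> \<union> \<Gamma>) (\<lambda>z. g (Some z))"
    by (simp add: o_def)
  assume "0 < e"
  have "openin (subtopology riemann_sphere ?K)
      {x \<in> topspace (subtopology riemann_sphere ?K). g x \<in> ball 0 e}"
    by (rule openin_continuous_map_preimage[OF g'(1)]) auto
  then obtain T where T: "openin riemann_sphere T"
    "{x \<in> topspace (subtopology riemann_sphere ?K). g x \<in> ball 0 e} = T \<inter> ?K"
    by (auto simp: openin_subtopology)
  have "None \<in> {x \<in> topspace (subtopology riemann_sphere ?K). g x \<in> ball 0 e}"
    using g' \<open>0 < e\<close> by (simp add: riemann_sphere_def)
  then have "None \<in> T" using T(2) by blast
  \<comment> \<open>Open neighbourhoods of infinity are complements of compact sets, so they contain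
    all points of large modulus.\<close>
  then obtain C where C: "compact C" "T = insert None (Some ` (- C))"
    using T(1) by (auto simp: riemann_sphere_def openin_Alexandroff_compactification Compl_eq_Diff_UNIV)
  then obtain B where B: "\<And>z. z \<in> C \<Longrightarrow> norm z \<le> B"
    using bounded_iff compact_imp_bounded by metis
  show "\<exists>B. \<forall>z\<in>outside \<Gamma> \<union> \<Gamma>. B \<le> norm z \<longrightarrow> norm (g (Some z)) < e"
  proof (intro exI[of _ "B + 1"] ballI impI)
    fix z assume z: "z \<in> outside \<Gamma> \<union> \<Gamma>" "B + 1 \<le> norm z"
    then have "z \<notin> C" using B by force
    then have "Some z \<in> T \<inter> ?K" using z C by blast
    then have "g (Some z) \<in> ball 0 e" using T(2) by blast
    then show "norm (g (Some z)) < e" by simp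
  qed
qed

section \<open>Reflection in a line\<close>

text \<open>The inner map is antiholomorphic, and the outer conjugation restores holomorphy. With
  \<open>c = cnj a\<close> and \<open>d = 2 * b\<close> it is the reflection in the line
  \<open>a \<bullet> z = b\<close>.\<close>

lemma holomorphic_reflection:
  assumes "G holomorphic_on T" "open T" "c \<noteq> 0"
    and "\<And>z. z \<in> S \<Longrightarrow> (d - a * cnj z) / c \<in> T" "open S"
  shows "(\<lambda>z. cnj (G ((d - a * cnj z) / c))) holomorphic_on S"
proof -
  have "(\<lambda>w. G ((d - a * w) / c)) holomorphic_on cnj ` S"
    using assms
    by (intro holomorphic_on_compose_gen[of "\<lambda>w. (d - a * w) / c" "cnj ` S" G T, unfolded o_def])
      (auto intro!: holomorphic_intros)
  from holomorphic_on_compose_cnj_cnj[OF this \<open>open S\<close>] show ?thesis by (simp add: o_def)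
qed

theorem theorem1p6:
  fixes \<Gamma> :: "complex set"
  assumes "jordan_curve \<Gamma>"
    and "\<exists>H. open_half_plane H \<and> \<Gamma> \<subseteq> closure H \<and>
           (\<exists>p q. p \<noteq> q \<and> \<Gamma> \<inter> frontier H = closed_segment p q)"
  shows "\<not> MP_solvable \<Gamma>"
proof
  assume "MP_solvable \<Gamma>"
  then obtain f g where f: "continuous_on (closure (inside \<Gamma>)) f" "f analytic_on inside \<Gamma>"
    and g: "g \<in> A_ext (jordan_exterior \<Gamma>)"
    and nc: "\<not> g constant_on (riemann_sphere closure_of jordan_exterior \<Gamma>)"
    and fg: "\<And>z. z \<in> \<Gamma> \<Longrightarrow> f z = cnj (g (Some z))"
    unfolding MP_solvable_def A_int_def by blast
  obtain a b p q where a: "a \<noteq> 0" and \<Gamma>H: "\<Gamma> \<subseteq> {z. a \<bullet> z \<le> b}" and "p \<noteq> q"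
    and seg: "\<Gamma> \<inter> {z. a \<bullet> z = b} = closed_segment p q"
    using assms(2) by (force simp: open_half_plane_def frontier_halfspace_lt)
  define H where "H = {z. a \<bullet> z < b}"
  define G where "G = (\<lambda>z. g (Some z))"
  note G = A_ext_planeD(1,2)[OF assms(1) g, folded G_def]
  have G_inf: "\<exists>B. \<forall>z\<in>outside \<Gamma> \<union> \<Gamma>. B \<le> norm z \<longrightarrow> norm (G z) < e" if "0 < e" for e
    unfolding G_def by (rule A_ext_planeD(3)[OF assms(1) g that])
  obtain c where c: "simple_path c" "pathfinish c = pathstart c" "path_image c = \<Gamma>"
    using assms(1) by (auto simp: jordan_curve_def)
  note J = Jordan_inside_outside[OF c(1,2), unfolded c(3)]
  have frI: "frontier (inside \<Gamma>) = \<Gamma>" and frO: "frontier (outside \<Gamma>) = \<Gamma>" using J by blast+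
  have clI: "closure (inside \<Gamma>) = inside \<Gamma> \<union> \<Gamma>"
    using frI closure_Un_frontier[of "inside \<Gamma>"] by simp
  have clO: "closure (outside \<Gamma>) = outside \<Gamma> \<union> \<Gamma>"
    using frO closure_Un_frontier[of "outside \<Gamma>"] by simp
  have "open H" by (simp add: H_def open_halfspace_lt)

  \<comment> \<open>Position of the two sides of the curve relative to the half-plane\<close>
  have below: "{z. b < a \<bullet> z} \<subseteq> outside \<Gamma>"
    using outside_subset_convex[OF convex_halfspace_le \<Gamma>H] by force
  have insH: "inside \<Gamma> \<subseteq> H"
  proof -
    have "inside \<Gamma> \<subseteq> {z. a \<bullet> z \<le> b}"
      using below inside_Int_outside[of \<Gamma>] by (force simp del: inside_Int_outside)
    \<comment> \<open>The inside is open, so it cannot touch the boundary line of the closed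
      half-plane.\<close>
    then have "inside \<Gamma> \<subseteq> interior {z. a \<bullet> z \<le> b}"
      using J by (intro interior_maximal) auto
    then show ?thesis using a by (simp add: H_def)
  qed
  have clIH: "closure (inside \<Gamma>) \<subseteq> {z. a \<bullet> z \<le> b}"
    using insH \<Gamma>H clI by (auto simp: H_def)
  have off: "z \<in> outside \<Gamma> \<union> \<Gamma>" if "b \<le> a \<bullet> z" for z
  proof -
    have "z \<notin> inside \<Gamma>" using insH that by (auto simp: H_def)
    then show ?thesis using J by blast
  qed

  \<comment> \<open>The reflected function\<close>
  \<comment> \<open>Since \<open>2 * (a \<bullet> z) = cnj a * z + a * cnj z\<close>, the line is
    \<open>cnj a * z = 2 * b - a * cnj z\<close>; solving for \<open>z\<close> gives the
    reflection.\<close>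
  define R where "R z = (of_real (2 * b) - a * cnj z) / cnj a" for z
  define F where "F z = cnj (G (R z))" for z
  have inner_eq: "x \<bullet> y = Re (cnj x * y)" for x y :: complex
    by (simp add: inner_complex_def)
  have aR: "a \<bullet> R z = 2 * b - a \<bullet> z" for z
    using a by (simp add: inner_eq R_def)
  have R_line: "R z = z" if "a \<bullet> z = b" for z
  proof -
    have "of_real (2 * b) - a * cnj z = cnj a * z"
      using that by (intro complex_eqI) (auto simp: inner_complex_def algebra_simps)
    then show ?thesis using a by (simp add: R_def)
  qed
  \<comment> \<open>Ensures that \<open>R z\<close> tends to infinity with \<open>z\<close>, so that
    \<open>F\<close> inherits the decay of \<open>G\<close>. The subtracted constant is
    \<open>norm (R 0)\<close>.\<close>
  have normR: "norm z - 2 * \<bar>b\<bar> / norm a \<le> norm (R z)" for z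
  proof -
    have "norm (a * cnj z) - norm (of_real (2 * b) :: complex) \<le> norm (of_real (2 * b) - a * cnj z)"
      by (metis norm_minus_commute norm_triangle_ineq2)
    then have "norm a * norm z - 2 * \<bar>b\<bar> \<le> norm (of_real (2 * b) - a * cnj z)"
      by (simp add: norm_mult)
    then have "(norm a * norm z - 2 * \<bar>b\<bar>) / norm a \<le> norm (of_real (2 * b) - a * cnj z) / norm a"
      by (intro divide_right_mono) auto
    moreover have "(norm a * norm z - 2 * \<bar>b\<bar>) / norm a = norm z - 2 * \<bar>b\<bar> / norm a"
      using a by (simp add: diff_divide_distrib)
    ultimately show ?thesis
      by (simp only: R_def norm_divide complex_mod_cnj)
  qed
  have R_out: "R z \<in> outside \<Gamma> \<union> \<Gamma>" if "a \<bullet> z \<le> b" for z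
    using that by (intro off) (simp add: aR)
  have F_hol: "F holomorphic_on H"
    unfolding F_def R_def
  proof (rule holomorphic_reflection)
    fix z assume "z \<in> H"
    then have "b < a \<bullet> R z" by (simp add: aR H_def)
    then show "(of_real (2 * b) - a * cnj z) / cnj a \<in> outside \<Gamma>"
      using below by (auto simp: R_def)
  qed (use G J a \<open>open H\<close> in auto)
  have F_cont: "continuous_on {z. a \<bullet> z \<le> b} F"
    unfolding F_def
  proof (intro continuous_intros continuous_on_compose2[OF G(2)])
    show "continuous_on {z. a \<bullet> z \<le> b} R"
      unfolding R_def using a by (intro continuous_intros) auto
  qed (use R_out in auto)
  have F_line: "F z = cnj (G z)" if "a \<bullet> z = b" for z
    using R_line[OF that] by (simp add: F_def)

  \<comment> \<open>Identification of \<open>f\<close> with \<open>F\<close> inside the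
    curve\<close>
  have fF_inside: "f z = F z" if "z \<in> inside \<Gamma>" for z
  proof -
    obtain m e where me: "0 < e" "m \<in> \<Gamma>" "a \<bullet> m = b" "ball m e \<inter> \<Gamma> = ball m e \<inter> {z. a \<bullet> z = b}"
      using jordan_curve_ball_in_line[OF assms(1) a \<open>p \<noteq> q\<close> seg] by metis
    let ?B = "ball m e"
    have "m \<in> closure (inside \<Gamma>)" using me clI by auto
    then obtain w where w: "w \<in> inside \<Gamma>" "w \<in> ?B"
      using me(1) closure_approachable by (metis dist_commute mem_ball)
    \<comment> \<open>The half-disc is connected, avoids the curve and contains the inside point
      \<open>w\<close>, so it lies wholly inside.\<close>
    have BH: "?B \<inter> H \<subseteq> inside \<Gamma>"
    proof -
      have "connected (?B \<inter> H)"
        unfolding H_def by (intro convex_connected convex_Int convex_ball convex_halfspace_lt)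
      moreover have "?B \<inter> H \<inter> \<Gamma> = {}" using me(4) by (auto simp: H_def)
      then have "?B \<inter> H \<subseteq> inside \<Gamma> \<union> outside \<Gamma>" using J by blast
      ultimately have "inside \<Gamma> \<inter> (?B \<inter> H) = {} \<or> outside \<Gamma> \<inter> (?B \<inter> H) = {}"
        using J by (intro connectedD) auto
      then have "outside \<Gamma> \<inter> (?B \<inter> H) = {}" using w insH by blast
      then show ?thesis using \<open>?B \<inter> H \<subseteq> inside \<Gamma> \<union> outside \<Gamma>\<close> by blast
    qed
    \<comment> \<open>Extending the difference by 0 past the line is continuous, because
      \<open>f\<close> and \<open>F\<close> both equal \<open>cnj G\<close> on the diameter. Pasting
      makes it holomorphic, and vanishing on one half-disc then forces it to vanish on the whole
      disc.\<close>
    define k where "k z = (if a \<bullet> z \<le> b then f z - F z else 0)" for z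
    have Bcl: "{z \<in> ?B. a \<bullet> z \<le> b} \<subseteq> closure (inside \<Gamma>)"
    proof
      fix z assume "z \<in> {z \<in> ?B. a \<bullet> z \<le> b}"
      then show "z \<in> closure (inside \<Gamma>)"
        using BH me(4) clI by (cases "a \<bullet> z = b") (auto simp: H_def)
    qed
    have k_cont: "continuous_on ?B k"
      unfolding k_def
    proof (rule continuous_on_cases_le)
      show "continuous_on {z \<in> ?B. a \<bullet> z \<le> b} (\<lambda>z. f z - F z)"
        by (intro continuous_intros continuous_on_subset[OF f(1) Bcl] continuous_on_subset[OF F_cont]) auto
      show "f z - F z = 0" if "z \<in> ?B" "a \<bullet> z = b" for z
      proof -
        have "z \<in> \<Gamma>" using that me(4) by blast
        then show ?thesis using fg F_line[OF that(2)] by (simp add: G_def)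
      qed
    qed (intro continuous_intros)+
    have "k holomorphic_on ?B"
    proof (rule holomorphic_on_paste_across_line[of _ a _ b])
      have "(\<lambda>z. f z - F z) holomorphic_on ?B \<inter> {z. a \<bullet> z < b}"
        using BH f(2) F_hol unfolding H_def
        by (intro holomorphic_intros)
          (auto intro: holomorphic_on_subset analytic_imp_holomorphic)
      then show "k holomorphic_on ?B \<inter> {z. a \<bullet> z < b}"
        by (rule holomorphic_transform) (auto simp: k_def)
      have "(\<lambda>z. 0) holomorphic_on ?B \<inter> {z. b < a \<bullet> z}" by simp
      then show "k holomorphic_on ?B \<inter> {z. b < a \<bullet> z}"
        by (rule holomorphic_transform) (auto simp: k_def)
    qed (use a k_cont in auto)
    have ne: "?B \<inter> {z. b < a \<bullet> z} \<noteq> {}"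
    proof -
      \<comment> \<open>Half a radius from the centre along the outward unit normal.\<close>
      have "m + (e / 2 / norm a) *\<^sub>R a \<in> ?B" using a me(1) by (simp add: dist_norm)
      moreover have "b < a \<bullet> (m + (e / 2 / norm a) *\<^sub>R a)"
        using a me by (simp add: inner_add_right)
      ultimately show ?thesis by blast
    qed
    have k0: "k z = 0" if "z \<in> ?B" for z
    proof (rule analytic_continuation_open[of "?B \<inter> {z. b < a \<bullet> z}" ?B k "\<lambda>_. 0"])
      show "open (?B \<inter> {z. b < a \<bullet> z})" by (intro open_Int open_ball open_halfspace_gt)
    qed (use ne \<open>k holomorphic_on ?B\<close> that in \<open>auto simp: k_def\<close>)
    show "f z = F z"
    proof (rule analytic_continuation_open[of "?B \<inter> H" "inside \<Gamma>" f F])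
      show "open (?B \<inter> H)" using \<open>open H\<close> by auto
      show "?B \<inter> H \<noteq> {}" using w insH by blast
      show "f y = F y" if "y \<in> ?B \<inter> H" for y
        using k0[of y] that by (auto simp: k_def H_def)
    qed (use J BH that f F_hol insH in \<open>auto intro: analytic_imp_holomorphic holomorphic_on_subset\<close>)
  qed
  have F_curve: "F z = cnj (G z)" if "z \<in> \<Gamma>" for z
  proof -
    have "f z - F z = 0"
    \<comment> \<open>Continuity carries the identity from the inside to the curve.\<close>
    proof (rule continuous_constant_on_closure[of "inside \<Gamma>" "\<lambda>z. f z - F z" 0 z])
      show "continuous_on (closure (inside \<Gamma>)) (\<lambda>z. f z - F z)"
        by (intro continuous_intros f continuous_on_subset[OF F_cont clIH])
    qed (use that clI fF_inside in auto)
    then show ?thesis using fg[OF that] by (simp add: G_def)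
  qed

  \<comment> \<open>Comparison of \<open>F\<close> and \<open>G\<close> outside the curve\<close>
  define U where "U = H \<inter> outside \<Gamma>"
  have opU: "open U" using \<open>open H\<close> J by (auto simp: U_def)
  have clU: "closure U \<subseteq> {z. a \<bullet> z \<le> b}" "closure U \<subseteq> outside \<Gamma> \<union> \<Gamma>"
    using closure_mono[of U H] closure_mono[of U "outside \<Gamma>"] clO a
    by (auto simp: U_def H_def)
  \<comment> \<open>The frontier of \<open>U\<close> lies in the boundary line and the curve, and
    the identity is known on both.\<close>
  have frU: "F z = cnj (G z)" if "z \<in> frontier U" for z
  proof -
    have "z \<in> frontier H \<or> z \<in> \<Gamma>"
      using that frontier_Int_subset[of H "outside \<Gamma>"] frO by (auto simp: U_def)
    then show ?thesis
      using F_line F_curve a by (auto simp: H_def frontier_halfspace_lt)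
  qed
  have G_hol: "G holomorphic_on U" and F_holU: "F holomorphic_on U"
    using G(1) F_hol by (auto simp: U_def intro: holomorphic_on_subset)
  have G_contU: "continuous_on (closure U) G" and F_contU: "continuous_on (closure U) F"
    using clU G(2) F_cont continuous_on_subset by blast+
  have small: "\<exists>B. \<forall>z\<in>closure U. B \<le> norm z \<longrightarrow> norm (G z) + norm (F z) \<le> e" if e: "0 < e" for e
  proof -
    obtain B where B: "\<And>z. z \<in> outside \<Gamma> \<union> \<Gamma> \<Longrightarrow> B \<le> norm z \<Longrightarrow> norm (G z) < e / 2"
      using G_inf[OF half_gt_zero[OF e]] by blast
    show ?thesis
    proof (intro exI[of _ "B + 2 * \<bar>b\<bar> / norm a"] ballI impI)
      fix z assume z: "z \<in> closure U" "B + 2 * \<bar>b\<bar> / norm a \<le> norm z"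
      have "0 \<le> 2 * \<bar>b\<bar> / norm a" by simp
      then have "B \<le> norm z" "B \<le> norm (R z)" using z(2) normR[of z] by linarith+
      moreover have "z \<in> outside \<Gamma> \<union> \<Gamma>" "R z \<in> outside \<Gamma> \<union> \<Gamma>"
        using z(1) clU R_out[of z] by auto
      ultimately have "norm (G z) < e / 2" "norm (G (R z)) < e / 2" by (blast intro: B)+
      then show "norm (G z) + norm (F z) \<le> e" by (simp add: F_def)
    qed
  qed
  have "U \<noteq> {}"
  proof
    assume "U = {}"
    then have "H \<subseteq> closure (inside \<Gamma>)" using J clI unfolding U_def by blast
    moreover have "bounded (closure (inside \<Gamma>))" using J bounded_closure by blast
    ultimately obtain M where M: "\<And>z. z \<in> H \<Longrightarrow> norm z \<le> M"
      by (meson bounded_iff subsetD)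
    \<comment> \<open>The first summand pushes \<open>- s *\<^sub>R a\<close> into \<open>H\<close>,
      the second pushes its norm beyond \<open>M\<close>.\<close>
    define s where "s = (\<bar>b\<bar> + 1) / (norm a)\<^sup>2 + (\<bar>M\<bar> + 1) / norm a"
    have s: "(\<bar>b\<bar> + 1) / (norm a)\<^sup>2 \<le> s" "(\<bar>M\<bar> + 1) / norm a \<le> s" by (simp_all add: s_def)
    then have s': "\<bar>b\<bar> + 1 \<le> s * (norm a)\<^sup>2" "\<bar>M\<bar> + 1 \<le> s * norm a"
      using a by (simp_all add: pos_divide_le_eq)
    have as: "a \<bullet> (- s *\<^sub>R a) = - (s * (norm a)\<^sup>2)" by (simp add: dot_square_norm)
    have "- s *\<^sub>R a \<in> H" using s' unfolding H_def mem_Collect_eq as by linarith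
    then have "norm (- s *\<^sub>R a) \<le> M" by (rule M)
    then have "\<bar>s\<bar> * norm a \<le> M" by simp
    moreover have "s * norm a \<le> \<bar>s\<bar> * norm a" by (intro mult_right_mono) auto
    ultimately show False using s' by linarith
  qed

  \<comment> \<open>Constancy of the exterior function\<close>
  then obtain z0 d where D: "0 < d" "ball z0 d \<subseteq> U"
    using opU open_contains_ball by blast
  \<comment> \<open>Where \<open>F = cnj G\<close>, the functions \<open>G - F\<close> and
    \<open>\<i> * (G + F)\<close> are \<open>2 * \<i> * Im G\<close> and
    \<open>2 * \<i> * Re G\<close>, both purely imaginary. Each is therefore constant on the ball,
    and together they determine \<open>G\<close> there.\<close>
  have "(\<lambda>z. G z - F z) constant_on ball z0 d"
  proof (rule vanishing_Re_constant_on[OF opU])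
    show "\<exists>B. \<forall>z\<in>closure U. B \<le> norm z \<longrightarrow> norm (G z - F z) \<le> e" if "0 < e" for e
      using small[OF that] norm_triangle_ineq4 order_trans by meson
  qed (use D frU in \<open>auto intro!: holomorphic_intros continuous_intros G_hol F_holU G_contU F_contU\<close>)
  then obtain c1 where c1: "\<And>z. z \<in> ball z0 d \<Longrightarrow> G z - F z = c1" by (auto simp: constant_on_def)
  have "(\<lambda>z. \<i> * (G z + F z)) constant_on ball z0 d"
  proof (rule vanishing_Re_constant_on[OF opU])
    show "\<exists>B. \<forall>z\<in>closure U. B \<le> norm z \<longrightarrow> norm (\<i> * (G z + F z)) \<le> e" if "0 < e" for e
    proof -
      have "norm (\<i> * (G z + F z)) \<le> norm (G z) + norm (F z)" for z
        by (simp add: norm_mult norm_triangle_ineq)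
      then show ?thesis using small[OF that] order_trans by meson
    qed
  qed (use D frU in \<open>auto intro!: holomorphic_intros continuous_intros G_hol F_holU G_contU F_contU\<close>)
  then obtain c2 where c2: "\<And>z. z \<in> ball z0 d \<Longrightarrow> \<i> * (G z + F z) = c2" by (auto simp: constant_on_def)
  define C where "C = (c1 - \<i> * c2) / 2"
  have GC: "G z = C" if "z \<in> ball z0 d" for z
    unfolding C_def c1[OF that, symmetric] c2[OF that, symmetric] by (simp add: algebra_simps)
  \<comment> \<open>The outside is connected, so the constant spreads from the ball to all of
    it.\<close>
  have GO: "G z = C" if "z \<in> outside \<Gamma>" for z
  proof (rule analytic_continuation_open[of "ball z0 d" "outside \<Gamma>" G "\<lambda>_. C"])
    show "ball z0 d \<subseteq> outside \<Gamma>" using D by (auto simp: U_def)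
  qed (use J D GC G(1) that in auto)
  \<comment> \<open>The outside is unbounded and \<open>G\<close> decays there, so the constant
    matches the value 0 of \<open>g\<close> at infinity.\<close>
  have "C = 0"
  proof (rule ccontr)
    assume "C \<noteq> 0"
    then have "0 < norm C" by simp
    from G_inf[OF this] obtain B where B: "\<And>z. z \<in> outside \<Gamma> \<Longrightarrow> B \<le> norm z \<Longrightarrow> norm (G z) < norm C"
      by blast
    have "\<not> bounded (outside \<Gamma>)" using J by simp
    then obtain z where "z \<in> outside \<Gamma>" "B < norm z" by (force simp: bounded_iff not_le)
    then show False using B[of z] GO[of z] by simp
  qed
  have "G z = C" if "z \<in> outside \<Gamma> \<union> \<Gamma>" for z
    using continuous_constant_on_closure[of "outside \<Gamma>" G C z] that clO G(2) GO by auto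
  moreover have "g None = 0" using g by (simp add: A_ext_def)
  ultimately have "g constant_on (riemann_sphere closure_of jordan_exterior \<Gamma>)"
    unfolding jordan_exterior_closure_of[OF assms(1)] constant_on_def
    using \<open>C = 0\<close> by (auto simp: G_def)
  with nc show False by contradiction
qed

end
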